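(* Let $\theta=p/q\in(0,1]$, where $p,q\in\mathbb{N}$. Let $\mathcal{G}(\theta)=(a_n)_{n=1}^\infty$. If $\Upsilon(p,q)$ divides $q$, then $$a_1=\frac{q+\Upsilon(p,q)}{p},$$ and $$\frac{p}{q}-\sum_{i=1}^{n-1}\frac{1}{a_i}=\frac{1}{\frac{q}{\Upsilon(p,q)}\prod_{i=1}^{n-1}a_i},\quad n\geqslant 2.$$ Hence, $$a_n=\frac{q}{\Upsilon(p,q)}\prod_{i=1}^{n-1}a_i+1,\quad n\geqslant 2.$$
   Context: $\mathbb{N}$ is the set of positive integers. For $p,q\in\mathbb{N}$, $\Upsilon(p,q)$ is the smallest positive integer $m$ such that $p$ divides $q+m$. For $\theta\in(0,1]$ let $G(\theta)=\lfloor 1/\theta\rfloor+1$. The greedy algorithm $\mathcal{G}$ produces the sequence $\mathcal{G}(\theta)=(a_n)_{n=1}^\infty$ of positive integers defined by $a_1=G(\theta)$ and $a_m=G\left(\theta-\sum_{n=1}^{m-1}1/a_n\right)$ for $m\geqslant 2$. *)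

theory Defs
  imports Complex_Main
begin

(* Meaningful for 0 < p, where the set of such m is nonempty. *)
definition Upsilon :: "nat \<Rightarrow> nat \<Rightarrow> nat" where
  "Upsilon p q = (LEAST m. 0 < m \<and> p dvd q + m)"

(* Intended for 0 < \<theta> \<le> 1, where the floor is at least 1 and nat does not truncate. *)
definition G :: "real \<Rightarrow> nat" where
  "G \<theta> = nat \<lfloor>1 / \<theta>\<rfloor> + 1"

(* The sequence is indexed from 1: for m = 1 the sum is empty and the value is G \<theta>.
   Index 0 is not part of the sequence; its value is irrelevant. *)
function greedy :: "real \<Rightarrow> nat \<Rightarrow> nat" where
  "greedy \<theta> m = G (\<theta> - (\<Sum>n = 1..m - 1. 1 / real (greedy \<theta> n)))"
  by auto
termination
  by (relation "measure snd") auto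

declare greedy.simps [simp del]

lemma greedy_1: "greedy \<theta> 1 = G \<theta>"
  by (subst greedy.simps) simp

end

theory Submission
  imports Defs
begin

text \<open>With \<open>m = \<Upsilon>(p,q)\<close> one has \<open>p a\<^sub>1 = q + m\<close>, so the first remainder is \<open>m / (q a\<^sub>1)\<close>, a unit
  fraction since \<open>m\<close> divides \<open>q\<close>. From a unit fraction \<open>1 / N\<close> the greedy algorithm picks \<open>N + 1\<close>
  and leaves the unit fraction \<open>1 / (N (N + 1))\<close>.\<close>

text \<open>\<open>Upsilon p q\<close> must be positive, so \<open>q + Upsilon p q\<close> is the
  first multiple of \<open>p\<close> strictly above \<open>q\<close>, even when \<open>p\<close>
  divides \<open>q\<close>. The cofactor appears as \<open>q div p + 1\<close> because that is the
  first greedy term.\<close>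

lemma add_Upsilon:
  assumes "0 < p"
  shows "q + Upsilon p q = p * (q div p + 1)"
proof -
  have lt: "q mod p < p"
    using assms by simp
  have eq: "q + (p - q mod p) = p * (q div p + 1)"
    using lt mult_div_mod_eq[of p q] by (simp only: distrib_left mult_1_right)
  have "Upsilon p q = p - q mod p"
    unfolding Upsilon_def
  proof (rule Least_equality)
    show "0 < p - q mod p \<and> p dvd q + (p - q mod p)"
      using lt eq by simp
  next
    fix m assume m: "0 < m \<and> p dvd q + m"
    then obtain c where c: "q + m = p * c"
      by (auto elim: dvdE)
    \<comment> \<open>Since \<open>p * (q div p) \<le> q < q + m\<close>, the cofactor
      \<open>c\<close> must exceed \<open>q div p\<close>.\<close>
    have "p * (q div p) < p * c"
      using m c mult_div_mod_eq[of p q] by linarith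
    then have "q div p + 1 \<le> c"
      using mult_less_cancel1 by fastforce
    then have "p * (q div p + 1) \<le> q + m"
      unfolding c by (rule mult_le_mono2)
    then show "p - q mod p \<le> m"
      using eq by linarith
  qed
  then show ?thesis
    using eq by simp
qed

lemma Upsilon_pos: "0 < p \<Longrightarrow> 0 < Upsilon p q"
  using add_Upsilon[of p q] dividend_less_times_div[of p q] by simp

lemma G_of_nat_divide: "G (real p / real q) = q div p + 1"
  by (simp add: G_def floor_divide_of_nat_eq)

text \<open>Division by zero yields 0, so \<open>n = 0\<close> is covered and no positivity check
  arises on use.\<close>

lemma G_inverse_nat: "G (1 / real n) = n + 1"
  by (simp add: G_def)

lemma greedy_Suc: "greedy \<theta> (Suc n) = G (\<theta> - (\<Sum>i = 1..n. 1 / real (greedy \<theta> i)))"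
  by (subst greedy.simps) simp

text \<open>A denominator that is a cast natural number lets \<open>G_inverse_nat\<close> give the
  next term at once. Induction starts at 1: for \<open>n = 0\<close> the claim would read
  \<open>p / q = Upsilon p q / q\<close>, which fails in general.\<close>

lemma greedy_remainder:
  assumes "0 < p" and "0 < q" and "Upsilon p q dvd q" and "1 \<le> n"
  shows "real p / real q - (\<Sum>i = 1..n. 1 / real (greedy (real p / real q) i))
    = 1 / real (q div Upsilon p q * (\<Prod>i = 1..n. greedy (real p / real q) i))"
  using \<open>1 \<le> n\<close>
proof (induction n rule: nat_induct_at_least)
  case base
  define m k b where "m = Upsilon p q" and "k = q div m" and "b = q div p + 1"
  have pb: "real p * real b = real q + real m"
    using add_Upsilon[OF assms(1), of q] unfolding m_def b_def
    by (metis of_nat_add of_nat_mult)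
  have q: "real q = real k * real m"
    using assms(3) unfolding k_def m_def by (metis dvd_div_mult_self of_nat_mult)
  have pos: "0 < real m" "0 < real k" "0 < real b"
    using Upsilon_pos[OF assms(1)] q assms(2) by (auto simp: m_def b_def intro: gr0I)
  \<comment> \<open>The numerator of the difference is \<open>p * b - q\<close>, which is
    \<open>m\<close> by \<open>pb\<close>.\<close>
  have "real p / real q - 1 / real b = real m / (real q * real b)"
    using pb pos assms(2) by (simp add: field_simps)
  also have "\<dots> = 1 / (real k * real b)"
    using pos by (simp add: q)
  finally show ?case
    by (simp add: greedy_1[unfolded One_nat_def] G_of_nat_divide b_def k_def m_def distrib_left)
next
  case (Suc n)
  let ?a = "greedy (real p / real q)"
  define N where "N = q div Upsilon p q * (\<Prod>i = 1..n. ?a i)"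
  have a: "?a (Suc n) = N + 1"
    unfolding greedy_Suc Suc.IH N_def by (rule G_inverse_nat)
  \<comment> \<open>Divisibility and \<open>0 < q\<close> give \<open>Upsilon p q \<le> q\<close>,
    so the quotient does not truncate to 0.\<close>
  have "0 < q div Upsilon p q"
    using assms Upsilon_pos[OF assms(1)] by (simp add: dvd_imp_le div_greater_zero_iff)
  moreover have "0 < ?a i" for i
    by (subst greedy.simps) (simp add: G_def)
  ultimately have "0 < N"
    unfolding N_def by (simp add: prod_pos)
  have "real p / real q - (\<Sum>i = 1..Suc n. 1 / real (?a i)) = 1 / real N - 1 / real (N + 1)"
    using Suc.IH by (simp add: a N_def)
  \<comment> \<open>Positivity matters here: at \<open>N = 0\<close> the left side would be -1 and
    the right side 0.\<close>
  also have "\<dots> = 1 / real (N * (N + 1))"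
    using \<open>0 < N\<close> by (simp add: field_simps)
  also have "N * (N + 1) = q div Upsilon p q * (\<Prod>i = 1..Suc n. ?a i)"
    by (simp add: a N_def algebra_simps)
  finally show ?case .
qed

theorem theorem1p9:
  fixes p q :: nat and \<theta> :: real and a :: "nat \<Rightarrow> nat"
  assumes "0 < p" and "0 < q"
    and "\<theta> = real p / real q"
    and "0 < \<theta>" and "\<theta> \<le> 1"
    and "a = greedy \<theta>"
    and "Upsilon p q dvd q"
  shows "real (a 1) = (real q + real (Upsilon p q)) / real p
    \<and> (\<forall>n\<ge>2. real p / real q - (\<Sum>i = 1..n - 1. 1 / real (a i))
          = 1 / (real q / real (Upsilon p q) * (\<Prod>i = 1..n - 1. real (a i))))
    \<and> (\<forall>n\<ge>2. real (a n) = real q / real (Upsilon p q) * (\<Prod>i = 1..n - 1. real (a i)) + 1)"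
proof (intro conjI allI impI)
  have a: "a = greedy (real p / real q)"
    using assms by simp
  have "real q + real (Upsilon p q) = real p * real (a 1)"
    using add_Upsilon[OF assms(1), of q] unfolding a greedy_1 G_of_nat_divide
    by (metis of_nat_add of_nat_mult)
  then show "real (a 1) = (real q + real (Upsilon p q)) / real p"
    using assms(1) by simp
  fix n :: nat assume n: "2 \<le> n"
  let ?N = "q div Upsilon p q * (\<Prod>i = 1..n - 1. a i)"
  \<comment> \<open>Divisibility makes \<open>div\<close> exact, so its cast is the real
    quotient.\<close>
  have N: "real ?N = real q / real (Upsilon p q) * (\<Prod>i = 1..n - 1. real (a i))"
    using assms(7) by (simp add: real_of_nat_div)
  have rem: "real p / real q - (\<Sum>i = 1..n - 1. 1 / real (a i)) = 1 / real ?N"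
    unfolding a by (rule greedy_remainder) (use assms n in auto)
  then show "real p / real q - (\<Sum>i = 1..n - 1. 1 / real (a i))
      = 1 / (real q / real (Upsilon p q) * (\<Prod>i = 1..n - 1. real (a i)))"
    unfolding N .
  have "a n = G (real p / real q - (\<Sum>i = 1..n - 1. 1 / real (a i)))"
    unfolding a by (rule greedy.simps)
  then have "a n = ?N + 1"
    unfolding rem G_inverse_nat .
  then show "real (a n) = real q / real (Upsilon p q) * (\<Prod>i = 1..n - 1. real (a i)) + 1"
    unfolding N[symmetric] by simp
qed

end
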